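(* Let $H$ be a Hilbert space and let $\mathcal{A}\subset B(H)$ be a unital C*-subalgebra. Then $\mathcal{A}$ has the complete TR(2,2)-property in $B(H)$.
   Context: For self-adjoint elements $x,y$, write $x<y$ if $y-x\ge\delta I$ for some $\delta>0$, where $I$ is the unit. "Unital C*-subalgebra" means containing the unit of $B(H)$. A unital C*-subalgebra $\mathcal{A}$ of a C*-algebra $\mathcal{B}$ has the $(k,m)$ tight Riesz interpolation property in $\mathcal{B}$ (TR(k,m)-property) if for all self-adjoint $x_1,\dots,x_k,y_1,\dots,y_m\in\mathcal{A}$: whenever there is a self-adjoint $b\in\mathcal{B}$ with $x_i<b<y_j$ for all $i,j$, there is a self-adjoint $a\in\mathcal{A}$ with $x_i<a<y_j$ for all $i,j$. $\mathcal{A}$ has the complete TR(k,m)-property in $\mathcal{B}$ if $M_n(\mathcal{A})$ has the TR(k,m)-property in $M_n(\mathcal{B})$ for every $n\ge 1$. *)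

theory Defs
  imports "HOL-Analysis.Analysis"
begin

text \<open>
  Complex Hilbert spaces. The real inner product of the superclass is the real part of the
  complex one, so norm and topology are the usual ones. \<open>cinner\<close> is linear in its first argument.
\<close>

class complex_hilbert_space = real_inner + complete_space +
  fixes scaleC :: "complex \<Rightarrow> 'a \<Rightarrow> 'a"  (infixr \<open>*\<^sub>C\<close> 75)
    and cinner :: "'a \<Rightarrow> 'a \<Rightarrow> complex"
  assumes scaleC_add_right: "c *\<^sub>C (x + y) = c *\<^sub>C x + c *\<^sub>C y"
    and scaleC_add_left: "(c + d) *\<^sub>C x = c *\<^sub>C x + d *\<^sub>C x"
    and scaleC_scaleC: "c *\<^sub>C d *\<^sub>C x = (c * d) *\<^sub>C x"
    and scaleC_of_real: "complex_of_real r *\<^sub>C x = r *\<^sub>R x"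
    and cinner_add_left: "cinner (x + y) z = cinner x z + cinner y z"
    and cinner_scaleC_left: "cinner (c *\<^sub>C x) y = c * cinner x y"
    and cinner_commute: "cinner x y = cnj (cinner y x)"
    and Re_cinner: "Re (cinner x y) = inner x y"

instantiation complex :: complex_hilbert_space
begin

definition scaleC_complex :: "complex \<Rightarrow> complex \<Rightarrow> complex"
  where "scaleC_complex c x = c * x"

definition cinner_complex :: "complex \<Rightarrow> complex \<Rightarrow> complex"
  where "cinner_complex x y = x * cnj y"

instance
  by standard
    (auto simp: scaleC_complex_def cinner_complex_def algebra_simps scaleR_conv_of_real inner_complex_def)

end

lemma cinner_scaleC_right: "cinner x (c *\<^sub>C y) = cnj c * cinner x y"
  by (metis cinner_commute cinner_scaleC_left complex_cnj_mult)

lemma cinner_self: "cinner x x = complex_of_real ((norm x)\<^sup>2)"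
proof (rule complex_eqI)
  show "Re (cinner x x) = Re (complex_of_real ((norm x)\<^sup>2))"
    by (simp add: Re_cinner power2_norm_eq_inner)
  have "Im (cinner x x) = - Im (cinner x x)"
    using arg_cong[OF cinner_commute[of x x], of Im] by simp
  then show "Im (cinner x x) = Im (complex_of_real ((norm x)\<^sup>2))"
    by simp
qed

lemma norm_scaleC: "norm (c *\<^sub>C x) = cmod c * norm x"
proof -
  have "complex_of_real ((norm (c *\<^sub>C x))\<^sup>2) = (c * cnj c) * complex_of_real ((norm x)\<^sup>2)"
    by (simp only: cinner_self[symmetric] cinner_scaleC_left cinner_scaleC_right mult.assoc mult.left_commute)
  also have "\<dots> = complex_of_real ((cmod c * norm x)\<^sup>2)"
    by (simp add: complex_norm_square[symmetric] power_mult_distrib del: of_real_power)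
  finally have "(norm (c *\<^sub>C x))\<^sup>2 = (cmod c * norm x)\<^sup>2"
    by (simp only: of_real_eq_iff)
  then show ?thesis
    by simp
qed

lemma bounded_linear_scaleC: "bounded_linear (\<lambda>x. c *\<^sub>C x)"
proof (rule bounded_linear_intro[where K = "cmod c"])
  show "c *\<^sub>C (r *\<^sub>R x) = r *\<^sub>R (c *\<^sub>C x)" for r x
    by (simp only: scaleC_of_real[symmetric] scaleC_scaleC mult.commute)
qed (simp_all add: scaleC_add_right norm_scaleC)


text \<open>
  The type of bounded linear functions in the library consists of the real-linear maps;
  \<open>B(H)\<close> is the set of its complex-linear members, with operator norm, composition \<open>o\<^sub>L\<close> and
  unit \<open>id_blinfun\<close> from the library.
\<close>

definition bounded_operators :: "('h::complex_hilbert_space \<Rightarrow>\<^sub>L 'h) set"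
  where "bounded_operators = {T. \<forall>c x. blinfun_apply T (c *\<^sub>C x) = c *\<^sub>C blinfun_apply T x}"

definition scaleC_op ::
    "complex \<Rightarrow> ('h::complex_hilbert_space \<Rightarrow>\<^sub>L 'h) \<Rightarrow> ('h \<Rightarrow>\<^sub>L 'h)"
  where "scaleC_op c T = Blinfun (\<lambda>x. c *\<^sub>C blinfun_apply T x)"

lemma scaleC_op_apply [simp]: "blinfun_apply (scaleC_op c T) x = c *\<^sub>C blinfun_apply T x"
  unfolding scaleC_op_def
  by (subst bounded_linear_Blinfun_apply)
    (auto intro: bounded_linear_compose[OF bounded_linear_scaleC blinfun.bounded_linear_right])

text \<open>\<open>is_adjoint T S\<close> states \<open>S = T\<^sup>*\<close>; such an \<open>S\<close> is unique.\<close>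

definition is_adjoint ::
    "('h::complex_hilbert_space \<Rightarrow>\<^sub>L 'h) \<Rightarrow> ('h \<Rightarrow>\<^sub>L 'h) \<Rightarrow> bool"
  where "is_adjoint T S \<longleftrightarrow>
    (\<forall>x y. cinner (blinfun_apply T x) y = cinner x (blinfun_apply S y))"

definition unital_cstar_subalgebra :: "('h::complex_hilbert_space \<Rightarrow>\<^sub>L 'h) set \<Rightarrow> bool"
  where "unital_cstar_subalgebra A \<longleftrightarrow>
    A \<subseteq> bounded_operators \<and>
    id_blinfun \<in> A \<and>
    (\<forall>S\<in>A. \<forall>T\<in>A. S + T \<in> A) \<and>
    (\<forall>c. \<forall>T\<in>A. scaleC_op c T \<in> A) \<and>
    (\<forall>S\<in>A. \<forall>T\<in>A. S o\<^sub>L T \<in> A) \<and>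
    (\<forall>T\<in>A. \<exists>S\<in>A. is_adjoint T S) \<and>
    closed A"


text \<open>
  Matrices are indexed by \<open>i, j < n\<close> and vanish outside that range, so that
  \<open>op_matrices n A\<close> is a faithful copy of \<open>M\<^sub>n(A)\<close>. An element of \<open>M\<^sub>n(B(H))\<close> is
  regarded as an operator on the direct sum \<open>H\<^sup>n\<close>, whose vectors are functions \<open>\<xi>\<close>
  of which only the entries \<open>\<xi> i\<close> with \<open>i < n\<close> matter.
\<close>

type_synonym 'h op_matrix = "nat \<Rightarrow> nat \<Rightarrow> 'h \<Rightarrow>\<^sub>L 'h"

definition op_matrices ::
    "nat \<Rightarrow> ('h::complex_hilbert_space \<Rightarrow>\<^sub>L 'h) set \<Rightarrow> 'h op_matrix set"
  where "op_matrices n A =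
    {X. (\<forall>i<n. \<forall>j<n. X i j \<in> A) \<and> (\<forall>i j. \<not> (i < n \<and> j < n) \<longrightarrow> X i j = 0)}"

definition mat_self_adjoint :: "nat \<Rightarrow> 'h::complex_hilbert_space op_matrix \<Rightarrow> bool"
  where "mat_self_adjoint n X \<longleftrightarrow> (\<forall>i<n. \<forall>j<n. is_adjoint (X i j) (X j i))"

definition mat_apply ::
    "nat \<Rightarrow> 'h::complex_hilbert_space op_matrix \<Rightarrow> (nat \<Rightarrow> 'h) \<Rightarrow> (nat \<Rightarrow> 'h)"
  where "mat_apply n X \<xi> = (\<lambda>i. \<Sum>j<n. blinfun_apply (X i j) (\<xi> j))"

definition vec_cinner ::
    "nat \<Rightarrow> (nat \<Rightarrow> 'h::complex_hilbert_space) \<Rightarrow> (nat \<Rightarrow> 'h) \<Rightarrow> complex"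
  where "vec_cinner n \<xi> \<eta> = (\<Sum>i<n. cinner (\<xi> i) (\<eta> i))"

definition mat_positive :: "nat \<Rightarrow> 'h::complex_hilbert_space op_matrix \<Rightarrow> bool"
  where "mat_positive n X \<longleftrightarrow> (\<forall>\<xi>. vec_cinner n (mat_apply n X \<xi>) \<xi> \<in> \<real>\<^sub>\<ge>\<^sub>0)"

definition mat_one :: "nat \<Rightarrow> 'h::complex_hilbert_space op_matrix"
  where "mat_one n = (\<lambda>i j. if i = j \<and> i < n then id_blinfun else 0)"

definition mat_less ::
    "nat \<Rightarrow> 'h::complex_hilbert_space op_matrix \<Rightarrow> 'h op_matrix \<Rightarrow> bool"
  where "mat_less n X Y \<longleftrightarrow>
    (\<exists>\<delta>>0. mat_positive n (\<lambda>i j. Y i j - X i j - \<delta> *\<^sub>R mat_one n i j))"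

text \<open>
  The TR(k,m)-property for algebras \<open>MA \<subseteq> MB\<close> of \<open>n \<times> n\<close> operator matrices.
  The order of a C*-subalgebra is that of the ambient \<open>M\<^sub>n(B(H)) = B(H\<^sup>n)\<close>.
\<close>

definition TR_property ::
    "nat \<Rightarrow> nat \<Rightarrow> nat \<Rightarrow> 'h::complex_hilbert_space op_matrix set \<Rightarrow> 'h op_matrix set \<Rightarrow> bool"
  where "TR_property n k m MA MB \<longleftrightarrow>
    (\<forall>x y. (\<forall>i<k. x i \<in> MA \<and> mat_self_adjoint n (x i)) \<and>
           (\<forall>j<m. y j \<in> MA \<and> mat_self_adjoint n (y j)) \<longrightarrow>
      (\<exists>b\<in>MB. mat_self_adjoint n b \<and>
        (\<forall>i<k. mat_less n (x i) b) \<and> (\<forall>j<m. mat_less n b (y j))) \<longrightarrow>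
      (\<exists>a\<in>MA. mat_self_adjoint n a \<and>
        (\<forall>i<k. mat_less n (x i) a) \<and> (\<forall>j<m. mat_less n a (y j))))"

definition complete_TR_property ::
    "nat \<Rightarrow> nat \<Rightarrow> ('h::complex_hilbert_space \<Rightarrow>\<^sub>L 'h) set \<Rightarrow> ('h \<Rightarrow>\<^sub>L 'h) set \<Rightarrow> bool"
  where "complete_TR_property k m A B \<longleftrightarrow>
    (\<forall>n\<ge>1. TR_property n k m (op_matrices n A) (op_matrices n B))"

end

theory Submission
  imports Defs
begin

subclass (in complex_hilbert_space) banach ..

text \<open>
  Write \<open>c = (x\<^sub>1 + x\<^sub>2)/2\<close>, \<open>e = (x\<^sub>2 - x\<^sub>1)/2\<close>, \<open>d = (y\<^sub>1 + y\<^sub>2)/2\<close>, \<open>f = (y\<^sub>2 - y\<^sub>1)/2\<close> and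
  \<open>m = d - c\<close>, reduced by a small multiple of the unit. It suffices to find \<open>g\<close> in the algebra
  such that \<open>\<plusminus>e \<le> g\<close> and \<open>\<plusminus>f \<le> m - g\<close> hold up to a small error. A solution \<open>g\<close> in the ambient algebra
  makes the block tridiagonal matrix with diagonal \<open>m\<close> and off-diagonal entries
  \<open>e, f, e, f, \<dots>\<close> positive, and so bounds its successive Schur complements from below:
  starting from \<open>S\<^sub>0 = m\<close>, \<open>R\<^sub>k = m - e S\<^sub>k\<^sup>-\<^sup>1 e \<ge> m - g\<close> and
  \<open>S\<^sub>k\<^sub>+\<^sub>1 = m - f R\<^sub>k\<^sup>-\<^sup>1 f \<ge> g\<close>. All of these lie in the smaller algebra. Since
  \<open>S + e S\<^sup>-\<^sup>1 e \<ge> \<plusminus>2e\<close>, the average of \<open>(S\<^sub>k + m - R\<^sub>k)/2\<close> over \<open>k < N\<close> dominates \<open>\<plusminus>e\<close>, and \<open>m\<close>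
  minus this average dominates \<open>\<plusminus>f\<close> up to the telescoping error \<open>(S\<^sub>0 - S\<^sub>N)/(2N)\<close>.
\<close>

section \<open>Vectors and operator matrices\<close>

text \<open>The real part of \<open>vec_cinner\<close>. Self-adjoint matrices have real quadratic
  forms, so the estimates can stay in real arithmetic.\<close>

definition vec_inner :: "nat \<Rightarrow> (nat \<Rightarrow> 'h::complex_hilbert_space) \<Rightarrow> (nat \<Rightarrow> 'h) \<Rightarrow> real"
  where "vec_inner n \<xi> \<eta> = (\<Sum>i<n. inner (\<xi> i) (\<eta> i))"

text \<open>The order between self-adjoint matrices is pointwise comparison of these forms. The
  ambient solution enters the core lemmas only through its form.\<close>

definition mat_form :: "nat \<Rightarrow> 'h::complex_hilbert_space op_matrix \<Rightarrow> (nat \<Rightarrow> 'h) \<Rightarrow> real"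
  where "mat_form n X \<xi> = vec_inner n (mat_apply n X \<xi>) \<xi>"

definition mat_mult ::
    "nat \<Rightarrow> 'h::complex_hilbert_space op_matrix \<Rightarrow> 'h op_matrix \<Rightarrow> 'h op_matrix"
  where "mat_mult n X Y = (\<lambda>i j. \<Sum>k<n. X i k o\<^sub>L Y k j)"

lemma cinner_add_right: "cinner x (y + z) = cinner x y + cinner x z"
  by (metis cinner_add_left cinner_commute complex_cnj_add)

lemma Re_vec_cinner: "Re (vec_cinner n \<xi> \<eta>) = vec_inner n \<xi> \<eta>"
  by (simp add: vec_cinner_def vec_inner_def Re_cinner)

lemma vec_cinner_commute: "vec_cinner n \<xi> \<eta> = cnj (vec_cinner n \<eta> \<xi>)"
  unfolding vec_cinner_def by (simp add: cinner_commute[symmetric])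

lemma vec_inner_commute: "vec_inner n \<xi> \<eta> = vec_inner n \<eta> \<xi>"
  by (simp add: vec_inner_def inner_commute)

lemma vec_inner_cong:
  "(\<And>i. i < n \<Longrightarrow> \<xi> i = \<xi>' i) \<Longrightarrow> (\<And>i. i < n \<Longrightarrow> \<eta> i = \<eta>' i) \<Longrightarrow> vec_inner n \<xi> \<eta> = vec_inner n \<xi>' \<eta>'"
  by (simp add: vec_inner_def)

lemma vec_cinner_cong:
  "(\<And>i. i < n \<Longrightarrow> \<xi> i = \<xi>' i) \<Longrightarrow> (\<And>i. i < n \<Longrightarrow> \<eta> i = \<eta>' i) \<Longrightarrow> vec_cinner n \<xi> \<eta> = vec_cinner n \<xi>' \<eta>'"
  by (simp add: vec_cinner_def)

lemma vec_inner_linear: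
  "vec_inner n (\<lambda>i. \<xi> i + \<eta> i) \<zeta> = vec_inner n \<xi> \<zeta> + vec_inner n \<eta> \<zeta>"
  "vec_inner n (\<lambda>i. \<xi> i - \<eta> i) \<zeta> = vec_inner n \<xi> \<zeta> - vec_inner n \<eta> \<zeta>"
  "vec_inner n (\<lambda>i. r *\<^sub>R \<xi> i) \<zeta> = r * vec_inner n \<xi> \<zeta>"
  "vec_inner n \<zeta> (\<lambda>i. \<xi> i + \<eta> i) = vec_inner n \<zeta> \<xi> + vec_inner n \<zeta> \<eta>"
  "vec_inner n \<zeta> (\<lambda>i. \<xi> i - \<eta> i) = vec_inner n \<zeta> \<xi> - vec_inner n \<zeta> \<eta>"
  "vec_inner n \<zeta> (\<lambda>i. r *\<^sub>R \<xi> i) = r * vec_inner n \<zeta> \<xi>"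
  by (simp_all add: vec_inner_def inner_simps sum.distrib sum_subtractf sum_distrib_left)

lemma vec_inner_self: "vec_inner n \<xi> \<xi> = (\<Sum>i<n. (norm (\<xi> i))\<^sup>2)"
  by (simp add: vec_inner_def power2_norm_eq_inner)

lemma vec_inner_self_nonneg: "0 \<le> vec_inner n \<xi> \<xi>"
  by (simp add: vec_inner_self sum_nonneg)

lemma mat_apply_vec:
  "mat_apply n X (\<lambda>i. \<xi> i + \<eta> i) = (\<lambda>i. mat_apply n X \<xi> i + mat_apply n X \<eta> i)"
  "mat_apply n X (\<lambda>i. \<xi> i - \<eta> i) = (\<lambda>i. mat_apply n X \<xi> i - mat_apply n X \<eta> i)"
  "mat_apply n X (\<lambda>i. r *\<^sub>R \<xi> i) = (\<lambda>i. r *\<^sub>R mat_apply n X \<xi> i)"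
  by (simp_all add: mat_apply_def blinfun.bilinear_simps sum.distrib sum_subtractf scaleR_sum_right)

lemma mat_apply_mat:
  "mat_apply n (\<lambda>i j. X i j + Y i j) \<xi> = (\<lambda>i. mat_apply n X \<xi> i + mat_apply n Y \<xi> i)"
  "mat_apply n (\<lambda>i j. X i j - Y i j) \<xi> = (\<lambda>i. mat_apply n X \<xi> i - mat_apply n Y \<xi> i)"
  "mat_apply n (\<lambda>i j. r *\<^sub>R X i j) \<xi> = (\<lambda>i. r *\<^sub>R mat_apply n X \<xi> i)"
  by (simp_all add: mat_apply_def blinfun.bilinear_simps sum.distrib sum_subtractf scaleR_sum_right)

text \<open>At indices from \<open>n\<close> on the left side is 0, whatever \<open>\<xi> i\<close>
  is. Hence the bound on \<open>i\<close>, and the use of such identities through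
  \<open>vec_inner_cong\<close> and \<open>vec_cinner_cong\<close>.\<close>

lemma mat_apply_one: "i < n \<Longrightarrow> mat_apply n (mat_one n) \<xi> i = \<xi> i"
  by (simp add: mat_apply_def mat_one_def if_distrib[of blinfun_apply] if_distribR cong: if_cong)

lemma mat_apply_mult: "mat_apply n (mat_mult n X Y) \<xi> = mat_apply n X (mat_apply n Y \<xi>)"
proof
  fix i
  have "mat_apply n (mat_mult n X Y) \<xi> i = (\<Sum>j<n. \<Sum>k<n. X i k (Y k j (\<xi> j)))"
    by (simp add: mat_apply_def mat_mult_def blinfun.sum_left)
  also have "\<dots> = mat_apply n X (mat_apply n Y \<xi>) i"
    by (subst sum.swap) (simp add: mat_apply_def blinfun.sum_right)
  finally show "mat_apply n (mat_mult n X Y) \<xi> i = mat_apply n X (mat_apply n Y \<xi>) i" .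
qed

lemma mat_apply_unit:
  "j < n \<Longrightarrow> mat_apply n X (\<lambda>l. if l = j then v else 0) i = X i j v"
  by (simp add: mat_apply_def if_distrib[of "blinfun_apply _"] cong: if_cong)

lemma mat_form_linear:
  "mat_form n (\<lambda>i j. X i j + Y i j) \<xi> = mat_form n X \<xi> + mat_form n Y \<xi>"
  "mat_form n (\<lambda>i j. X i j - Y i j) \<xi> = mat_form n X \<xi> - mat_form n Y \<xi>"
  "mat_form n (\<lambda>i j. r *\<^sub>R X i j) \<xi> = r * mat_form n X \<xi>"
  by (simp_all add: mat_form_def mat_apply_mat vec_inner_linear)

lemma mat_form_one: "mat_form n (mat_one n) \<xi> = vec_inner n \<xi> \<xi>"
  unfolding mat_form_def by (rule vec_inner_cong) (simp_all add: mat_apply_one)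

section \<open>Self-adjointness and order in terms of forms\<close>

text \<open>Vectors with a single nonzero entry recover the entrywise condition. The operator form
  serves products and inverses, where factors are moved across the inner product.\<close>

lemma mat_self_adjoint_iff:
  "mat_self_adjoint n X \<longleftrightarrow>
    (\<forall>\<xi> \<eta>. vec_cinner n (mat_apply n X \<xi>) \<eta> = vec_cinner n \<xi> (mat_apply n X \<eta>))"
proof -
  have z1: "cinner 0 z = 0" for z :: 'a
    using cinner_add_left[of 0 0 z] by simp
  have z2: "cinner z 0 = 0" for z :: 'a
    using cinner_add_right[of z 0 0] by simp
  have s1: "cinner (sum g I) z = (\<Sum>j\<in>I. cinner (g j) z)" for g I and z :: 'a
    by (induction I rule: infinite_finite_induct) (auto simp: cinner_add_left z1)
  have s2: "cinner z (sum g I) = (\<Sum>j\<in>I. cinner z (g j))" for g I and z :: 'a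
    by (induction I rule: infinite_finite_induct) (auto simp: cinner_add_right z2)
  show ?thesis
  proof (intro iffI allI)
    fix \<xi> \<eta> assume X: "mat_self_adjoint n X"
    have "vec_cinner n (mat_apply n X \<xi>) \<eta> = (\<Sum>i<n. \<Sum>j<n. cinner (X i j (\<xi> j)) (\<eta> i))"
      by (simp add: vec_cinner_def mat_apply_def s1)
    also have "\<dots> = (\<Sum>i<n. \<Sum>j<n. cinner (\<xi> j) (X j i (\<eta> i)))"
      using X by (intro sum.cong refl) (auto simp: mat_self_adjoint_def is_adjoint_def)
    also have "\<dots> = vec_cinner n \<xi> (mat_apply n X \<eta>)"
      by (subst sum.swap) (simp add: vec_cinner_def mat_apply_def s2)
    finally show "vec_cinner n (mat_apply n X \<xi>) \<eta> = vec_cinner n \<xi> (mat_apply n X \<eta>)" .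
  next
    assume *: "\<forall>\<xi> \<eta>. vec_cinner n (mat_apply n X \<xi>) \<eta> = vec_cinner n \<xi> (mat_apply n X \<eta>)"
    have "cinner (X i j u) v = cinner u (X j i v)" if "i < n" "j < n" for i j u v
    proof -
      have "cinner (X i j u) v
          = vec_cinner n (mat_apply n X (\<lambda>l. if l = j then u else 0)) (\<lambda>l. if l = i then v else 0)"
        using that by (simp add: vec_cinner_def mat_apply_unit z2 if_distrib[of "cinner _"] cong: if_cong)
      also have "\<dots> = cinner u (X j i v)"
        using that unfolding *[rule_format]
        by (simp add: vec_cinner_def mat_apply_unit z1 if_distrib[of cinner] if_distribR cong: if_cong)
      finally show ?thesis .
    qed
    then show "mat_self_adjoint n X"
      by (simp add: mat_self_adjoint_def is_adjoint_def)
  qed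
qed

lemma mat_self_adjoint_inner:
  "mat_self_adjoint n X \<Longrightarrow> vec_inner n (mat_apply n X \<xi>) \<eta> = vec_inner n \<xi> (mat_apply n X \<eta>)"
  by (simp add: mat_self_adjoint_iff flip: Re_vec_cinner)

text \<open>Self-adjointness makes the complex form equal to its own conjugate, so only the sign of
  its real part is left.\<close>

lemma mat_positive_iff:
  assumes "mat_self_adjoint n X"
  shows "mat_positive n X \<longleftrightarrow> (\<forall>\<xi>. 0 \<le> mat_form n X \<xi>)"
proof -
  have "Im (vec_cinner n (mat_apply n X \<xi>) \<xi>) = 0" for \<xi>
  proof -
    have "vec_cinner n (mat_apply n X \<xi>) \<xi> = cnj (vec_cinner n (mat_apply n X \<xi>) \<xi>)"
      using assms by (metis mat_self_adjoint_iff vec_cinner_commute)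
    then have "Im (vec_cinner n (mat_apply n X \<xi>) \<xi>) = - Im (vec_cinner n (mat_apply n X \<xi>) \<xi>)"
      by (metis cnj.sel(2))
    then show ?thesis by simp
  qed
  then show ?thesis
    by (simp add: mat_positive_def complex_nonneg_Reals_iff mat_form_def Re_vec_cinner)
qed

lemma mat_self_adjoint_linear:
  assumes "mat_self_adjoint n X"
  shows "mat_self_adjoint n Y \<Longrightarrow> mat_self_adjoint n (\<lambda>i j. X i j + Y i j)"
    and "mat_self_adjoint n Y \<Longrightarrow> mat_self_adjoint n (\<lambda>i j. X i j - Y i j)"
    and "mat_self_adjoint n (\<lambda>i j. r *\<^sub>R X i j)"
proof -
  have diff1: "cinner (x - y) z = cinner x z - cinner y z" for x y z :: 'a
    using cinner_add_left[of "x - y" y z] by simp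
  have diff2: "cinner x (y - z) = cinner x y - cinner x z" for x y z :: 'a
    using cinner_add_right[of x "y - z" z] by simp
  have scale: "cinner (r *\<^sub>R x) y = r * cinner x y" "cinner x (r *\<^sub>R y) = r * cinner x y" for x y :: 'a
    by (simp_all flip: scaleC_of_real add: cinner_scaleC_left cinner_scaleC_right)
  show "mat_self_adjoint n (\<lambda>i j. X i j + Y i j)" if "mat_self_adjoint n Y"
    using assms that
    by (simp add: mat_self_adjoint_def is_adjoint_def blinfun.bilinear_simps cinner_add_left cinner_add_right)
  show "mat_self_adjoint n (\<lambda>i j. X i j - Y i j)" if "mat_self_adjoint n Y"
    using assms that
    by (simp add: mat_self_adjoint_def is_adjoint_def blinfun.bilinear_simps diff1 diff2)
  show "mat_self_adjoint n (\<lambda>i j. r *\<^sub>R X i j)"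
    using assms
    by (simp add: mat_self_adjoint_def is_adjoint_def blinfun.bilinear_simps scale)
qed

lemma mat_self_adjoint_one: "mat_self_adjoint n (mat_one n)"
  unfolding mat_self_adjoint_iff by (intro allI vec_cinner_cong) (simp_all add: mat_apply_one)

lemma mat_less_iff:
  assumes "mat_self_adjoint n X" "mat_self_adjoint n Y"
  shows "mat_less n X Y \<longleftrightarrow>
    (\<exists>\<delta>>0. \<forall>\<xi>. mat_form n X \<xi> + \<delta> * vec_inner n \<xi> \<xi> \<le> mat_form n Y \<xi>)"
proof -
  have "mat_self_adjoint n (\<lambda>i j. Y i j - X i j - \<delta> *\<^sub>R mat_one n i j)" for \<delta>
    by (intro mat_self_adjoint_linear mat_self_adjoint_one assms)
  then show ?thesis
    by (simp add: mat_less_def mat_positive_iff mat_form_linear mat_form_one algebra_simps)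
qed

section \<open>The self-adjoint part of a matrix algebra\<close>

definition sa_matrices ::
    "nat \<Rightarrow> ('h::complex_hilbert_space \<Rightarrow>\<^sub>L 'h) set \<Rightarrow> 'h op_matrix set"
  where "sa_matrices n A = {X \<in> op_matrices n A. mat_self_adjoint n X}"

context
  fixes A :: "('h::complex_hilbert_space \<Rightarrow>\<^sub>L 'h) set"
  assumes A: "unital_cstar_subalgebra A"
begin

lemma subalgebra_closed:
  shows "S \<in> A \<Longrightarrow> T \<in> A \<Longrightarrow> S + T \<in> A"
    and "S \<in> A \<Longrightarrow> T \<in> A \<Longrightarrow> S o\<^sub>L T \<in> A"
    and "T \<in> A \<Longrightarrow> r *\<^sub>R T \<in> A"
    and "0 \<in> A" and "id_blinfun \<in> A" and "closed A"
    and "S \<in> A \<Longrightarrow> T \<in> A \<Longrightarrow> S - T \<in> A"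
    and "(\<And>i. i \<in> I \<Longrightarrow> f i \<in> A) \<Longrightarrow> sum f I \<in> A"
proof -
  show add: "S + T \<in> A" if "S \<in> A" "T \<in> A" for S T
    using A that by (simp add: unital_cstar_subalgebra_def)
  show "S \<in> A \<Longrightarrow> T \<in> A \<Longrightarrow> S o\<^sub>L T \<in> A" and one: "id_blinfun \<in> A" and "closed A"
    using A by (simp_all add: unital_cstar_subalgebra_def)
  show scale: "r *\<^sub>R T \<in> A" if "T \<in> A" for r T
  proof -
    have "r *\<^sub>R T = scaleC_op (complex_of_real r) T"
      by (rule blinfun_eqI) (simp add: blinfun.bilinear_simps scaleC_of_real)
    then show ?thesis
      using A that by (simp add: unital_cstar_subalgebra_def)
  qed
  show zero: "0 \<in> A"
    using scale[OF one, of 0] by simp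
  show "S - T \<in> A" if "S \<in> A" "T \<in> A"
    using add[OF that(1) scale[OF that(2), of "-1"]] by simp
  show "(\<And>i. i \<in> I \<Longrightarrow> f i \<in> A) \<Longrightarrow> sum f I \<in> A"
    by (induction I rule: infinite_finite_induct) (auto intro: add zero)
qed

lemma op_matrices_closed:
  assumes "X \<in> op_matrices n A"
  shows "Y \<in> op_matrices n A \<Longrightarrow> (\<lambda>i j. X i j + Y i j) \<in> op_matrices n A"
    and "Y \<in> op_matrices n A \<Longrightarrow> (\<lambda>i j. X i j - Y i j) \<in> op_matrices n A"
    and "(\<lambda>i j. r *\<^sub>R X i j) \<in> op_matrices n A"
    and "Y \<in> op_matrices n A \<Longrightarrow> mat_mult n X Y \<in> op_matrices n A"
proof -
  show "(\<lambda>i j. X i j + Y i j) \<in> op_matrices n A" "(\<lambda>i j. X i j - Y i j) \<in> op_matrices n A"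
    if "Y \<in> op_matrices n A"
    using assms that by (auto simp: op_matrices_def intro: subalgebra_closed)
  show "(\<lambda>i j. r *\<^sub>R X i j) \<in> op_matrices n A"
    using assms by (auto simp: op_matrices_def intro: subalgebra_closed)
  show "mat_mult n X Y \<in> op_matrices n A" if "Y \<in> op_matrices n A"
    using assms that
    by (auto simp: op_matrices_def mat_mult_def intro!: subalgebra_closed sum.neutral)
qed

lemma mat_one_in_op_matrices: "mat_one n \<in> op_matrices n A"
  by (auto simp: op_matrices_def mat_one_def intro: subalgebra_closed)

lemma sa_matrices_closed:
  assumes "X \<in> sa_matrices n A"
  shows "Y \<in> sa_matrices n A \<Longrightarrow> (\<lambda>i j. X i j + Y i j) \<in> sa_matrices n A"
    and "Y \<in> sa_matrices n A \<Longrightarrow> (\<lambda>i j. X i j - Y i j) \<in> sa_matrices n A"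
    and "(\<lambda>i j. r *\<^sub>R X i j) \<in> sa_matrices n A"
  using assms
  by (simp_all add: sa_matrices_def op_matrices_closed mat_self_adjoint_linear)

lemma mat_one_in_sa_matrices: "mat_one n \<in> sa_matrices n A"
  by (simp add: sa_matrices_def mat_one_in_op_matrices mat_self_adjoint_one)

end

section \<open>Bounds and inverses of operator matrices\<close>

text \<open>Cauchy-Schwarz in each row; the constant is the sum of the squared norms of all
  entries.\<close>

lemma mat_apply_bounded:
  "\<exists>M. \<forall>\<xi>. vec_inner n (mat_apply n X \<xi>) (mat_apply n X \<xi>) \<le> M * vec_inner n \<xi> \<xi>"
proof (intro exI allI)
  fix \<xi>
  have "(norm (mat_apply n X \<xi> i))\<^sup>2 \<le> (\<Sum>j<n. (norm (X i j))\<^sup>2) * vec_inner n \<xi> \<xi>" for i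
  proof -
    have "norm (mat_apply n X \<xi> i) \<le> (\<Sum>j<n. norm (X i j) * norm (\<xi> j))"
      unfolding mat_apply_def by (rule order_trans[OF norm_sum sum_mono]) (rule norm_blinfun)
    then have "(norm (mat_apply n X \<xi> i))\<^sup>2 \<le> (\<Sum>j<n. norm (X i j) * norm (\<xi> j))\<^sup>2"
      by (simp add: power_mono)
    also have "\<dots> \<le> (\<Sum>j<n. (norm (X i j))\<^sup>2) * (\<Sum>j<n. (norm (\<xi> j))\<^sup>2)"
      by (rule Cauchy_Schwarz_ineq_sum)
    finally show ?thesis by (simp add: vec_inner_self)
  qed
  then show "vec_inner n (mat_apply n X \<xi>) (mat_apply n X \<xi>)
      \<le> (\<Sum>i<n. \<Sum>j<n. (norm (X i j))\<^sup>2) * vec_inner n \<xi> \<xi>"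
    unfolding vec_inner_self[of n "mat_apply n X \<xi>"] sum_distrib_right by (rule sum_mono)
qed

text \<open>Expanding the nonnegative square of the norm of \<open>X \<xi> - \<xi>\<close> bounds
  twice the form by the squared norms of \<open>X \<xi>\<close> and \<open>\<xi>\<close>.\<close>

lemma mat_form_bounded: "\<exists>K. \<forall>\<xi>. mat_form n X \<xi> \<le> K * vec_inner n \<xi> \<xi>"
proof -
  obtain M where M: "\<And>\<xi>. vec_inner n (mat_apply n X \<xi>) (mat_apply n X \<xi>) \<le> M * vec_inner n \<xi> \<xi>"
    using mat_apply_bounded by blast
  have "mat_form n X \<xi> \<le> (M + 1) / 2 * vec_inner n \<xi> \<xi>" for \<xi>
    using vec_inner_self_nonneg[of n "\<lambda>i. mat_apply n X \<xi> i - \<xi> i"] M[of \<xi>]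
    by (simp add: vec_inner_linear mat_form_def vec_inner_commute[of n \<xi> "mat_apply n X \<xi>"] field_simps)
  then show ?thesis by blast
qed

text \<open>
  \<open>1 - \<epsilon> X\<close> is a strict contraction for small \<open>\<epsilon>\<close>, so the Neumann series converges
  entrywise in the closed algebra \<open>A\<close>.
\<close>
lemma strictly_positive_matrix_inverse:
  fixes A :: "('h::complex_hilbert_space \<Rightarrow>\<^sub>L 'h) set"
  assumes A: "unital_cstar_subalgebra A" and X: "X \<in> op_matrices n A"
    and "0 < \<delta>" and pos: "\<And>\<xi>. \<delta> * vec_inner n \<xi> \<xi> \<le> mat_form n X \<xi>"
  obtains Y where "Y \<in> op_matrices n A"
    and "\<And>\<xi> i. i < n \<Longrightarrow> mat_apply n X (mat_apply n Y \<xi>) i = \<xi> i"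
proof -
  obtain M0 where M0: "\<And>\<xi>. vec_inner n (mat_apply n X \<xi>) (mat_apply n X \<xi>) \<le> M0 * vec_inner n \<xi> \<xi>"
    using mat_apply_bounded by blast
  \<comment> \<open>The added \<open>\<delta>\<^sup>2\<close> makes \<open>M\<close> positive and at
    least \<open>\<delta>\<^sup>2\<close>, so that \<open>\<theta>\<close> below is
    nonnegative.\<close>
  define M where "M = \<bar>M0\<bar> + \<delta>\<^sup>2"
  have "0 < M" "\<delta>\<^sup>2 \<le> M"
    using \<open>0 < \<delta>\<close> by (simp_all add: M_def add_nonneg_pos)
  have M: "vec_inner n (mat_apply n X \<xi>) (mat_apply n X \<xi>) \<le> M * vec_inner n \<xi> \<xi>" for \<xi>
  proof (rule order_trans[OF M0 mult_right_mono])
    show "M0 \<le> M"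
      using abs_ge_self[of M0] zero_le_power2[of \<delta>] unfolding M_def by linarith
  qed (rule vec_inner_self_nonneg)
  \<comment> \<open>This \<open>\<epsilon>\<close> minimizes
    \<open>1 - 2 * \<epsilon> * \<delta> + \<epsilon>\<^sup>2 * M\<close>, and
    \<open>\<theta>\<close> is the minimum.\<close>
  define \<epsilon> where "\<epsilon> = \<delta> / M"
  define \<theta> where "\<theta> = 1 - \<delta>\<^sup>2 / M"
  have "0 < \<epsilon>" using \<open>0 < M\<close> \<open>0 < \<delta>\<close> by (simp add: \<epsilon>_def)
  have \<theta>: "0 \<le> \<theta>" "\<theta> < 1" using \<open>0 < M\<close> \<open>0 < \<delta>\<close> \<open>\<delta>\<^sup>2 \<le> M\<close> by (simp_all add: \<theta>_def)
  define T where "T = (\<lambda>i j. mat_one n i j - \<epsilon> *\<^sub>R X i j)"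
  have TA: "T \<in> op_matrices n A"
    unfolding T_def using A X by (intro op_matrices_closed mat_one_in_op_matrices)
  have T: "mat_apply n T \<xi> i = \<xi> i - \<epsilon> *\<^sub>R mat_apply n X \<xi> i" if "i < n" for \<xi> i
    using that by (simp add: T_def mat_apply_mat mat_apply_one)
  have contr: "vec_inner n (mat_apply n T \<xi>) (mat_apply n T \<xi>) \<le> \<theta> * vec_inner n \<xi> \<xi>" for \<xi>
  proof -
    let ?N = "vec_inner n \<xi> \<xi>"
    have "vec_inner n (mat_apply n T \<xi>) (mat_apply n T \<xi>)
        = vec_inner n (\<lambda>i. \<xi> i - \<epsilon> *\<^sub>R mat_apply n X \<xi> i) (\<lambda>i. \<xi> i - \<epsilon> *\<^sub>R mat_apply n X \<xi> i)"
      by (rule vec_inner_cong) (simp_all add: T)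
    also have "\<dots> = ?N - 2 * \<epsilon> * mat_form n X \<xi>
        + \<epsilon>\<^sup>2 * vec_inner n (mat_apply n X \<xi>) (mat_apply n X \<xi>)"
      by (simp add: vec_inner_linear mat_form_def vec_inner_commute[of n \<xi> "mat_apply n X \<xi>"]
          power2_eq_square algebra_simps)
    also have "\<dots> \<le> ?N - 2 * \<epsilon> * (\<delta> * ?N) + \<epsilon>\<^sup>2 * (M * ?N)"
      using pos[of \<xi>] M[of \<xi>] \<open>0 < \<epsilon>\<close>
      by (intro add_mono diff_mono mult_left_mono order_refl) auto
    also have "\<dots> = \<theta> * ?N"
      using \<open>0 < M\<close> by (simp add: \<epsilon>_def \<theta>_def power2_eq_square field_simps)
    finally show ?thesis .
  qed
  define P where "P = (\<lambda>k. (mat_mult n T ^^ k) (mat_one n))"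
  have P_Suc: "P (Suc k) = mat_mult n T (P k)" and P_0: "P 0 = mat_one n" for k
    by (simp_all add: P_def)
  have PA: "P k \<in> op_matrices n A" for k
    by (induction k) (auto simp: P_0 P_Suc intro: mat_one_in_op_matrices A op_matrices_closed TA)
  have P_bound: "vec_inner n (mat_apply n (P k) \<xi>) (mat_apply n (P k) \<xi>) \<le> \<theta> ^ k * vec_inner n \<xi> \<xi>" for k \<xi>
  proof (induction k)
    case 0
    have "vec_inner n (mat_apply n (P 0) \<xi>) (mat_apply n (P 0) \<xi>) = vec_inner n \<xi> \<xi>"
      by (rule vec_inner_cong) (simp_all add: P_0 mat_apply_one)
    then show ?case by simp
  next
    case (Suc k)
    show ?case
      using order_trans[OF contr mult_left_mono[OF Suc \<theta>(1)]]
      by (simp add: P_Suc mat_apply_mult mult.assoc)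
  qed
  \<comment> \<open>\<open>\<theta>\<close> contracts squared norms, whence the square root; the
    entry is read off from a vector supported at \<open>j\<close>.\<close>
  have entry: "norm (P k i j) \<le> sqrt \<theta> ^ k" if "i < n" "j < n" for i j k
  proof (rule norm_blinfun_bound)
    fix v :: 'h
    let ?u = "\<lambda>l. if l = j then v else 0"
    have "(norm (P k i j v))\<^sup>2 = (norm (mat_apply n (P k) ?u i))\<^sup>2"
      using that by (simp add: mat_apply_unit)
    also have "\<dots> \<le> vec_inner n (mat_apply n (P k) ?u) (mat_apply n (P k) ?u)"
      unfolding vec_inner_self using that by (intro member_le_sum) auto
    also have "\<dots> \<le> \<theta> ^ k * vec_inner n ?u ?u"
      by (rule P_bound)
    also have "vec_inner n ?u ?u = (norm v)\<^sup>2"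
      using that by (simp add: vec_inner_self if_distrib[of norm] if_distrib[of "\<lambda>x. x\<^sup>2"] cong: if_cong)
    also have "\<theta> ^ k * (norm v)\<^sup>2 = (sqrt \<theta> ^ k * norm v)\<^sup>2"
    proof -
      have "(sqrt \<theta> ^ k)\<^sup>2 = ((sqrt \<theta>)\<^sup>2) ^ k"
        by (simp only: power_mult[symmetric] mult.commute)
      then show ?thesis
        using \<theta> by (simp add: power_mult_distrib)
    qed
    finally show "norm (P k i j v) \<le> sqrt \<theta> ^ k * norm v"
      by (rule power2_le_imp_le) (simp add: \<theta>)
  qed (simp add: \<theta>)
  have summable: "summable (\<lambda>k. P k i j)" for i j
  proof (cases "i < n \<and> j < n")
    case True
    have "sqrt \<theta> < 1" using \<theta> by simp
    then have "summable (\<lambda>k. sqrt \<theta> ^ k)"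
      using \<theta> by (intro summable_geometric) simp
    then show ?thesis
      by (rule summable_comparison_test') (use True entry in blast)
  next
    case False
    then have "P k i j = 0" for k
      using PA[of k] by (simp add: op_matrices_def)
    then show ?thesis by simp
  qed
  \<comment> \<open>Since \<open>\<epsilon> X = 1 - T\<close>, the inverse of \<open>X\<close> is
    \<open>\<epsilon>\<close> times the sum of the powers of \<open>T\<close>.\<close>
  define Y where "Y = (\<lambda>i j. \<epsilon> *\<^sub>R (\<Sum>k. P k i j))"
  have YA: "Y \<in> op_matrices n A"
  proof -
    have "(\<Sum>k. P k i j) \<in> A" if "i < n" "j < n" for i j
    proof (rule closed_sequentially[OF subalgebra_closed(6)[OF A]])
      show "(\<lambda>m. \<Sum>k<m. P k i j) \<longlonglongrightarrow> (\<Sum>k. P k i j)"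
        by (rule summable_LIMSEQ[OF summable])
      show "\<And>m. (\<Sum>k<m. P k i j) \<in> A"
        using PA that by (intro subalgebra_closed(8)[OF A]) (simp add: op_matrices_def)
    qed
    moreover have "(\<Sum>k. P k i j) = 0" if "\<not> (i < n \<and> j < n)" for i j
      using PA that by (simp add: op_matrices_def)
    ultimately show ?thesis
      using subalgebra_closed(3)[OF A] by (auto simp: op_matrices_def Y_def)
  qed
  have "mat_apply n X (mat_apply n Y \<xi>) i = \<xi> i" if "i < n" for \<xi> i
  proof -
    define z where "z = (\<lambda>k. mat_apply n (P k) \<xi>)"
    have z_sums: "(\<lambda>k. \<epsilon> *\<^sub>R z k i) sums mat_apply n Y \<xi> i" for i
      unfolding z_def Y_def mat_apply_def blinfun.scaleR_left scaleR_sum_right[symmetric]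
      by (intro sums_scaleR_right sums_sum bounded_linear.sums[OF blinfun.bounded_linear_left]
          summable_sums summable)
    have "(\<lambda>k. \<epsilon> *\<^sub>R mat_apply n X (z k) i) sums mat_apply n X (mat_apply n Y \<xi>) i"
    proof -
      have "(\<lambda>k. \<Sum>j<n. X i j (\<epsilon> *\<^sub>R z k j)) sums (\<Sum>j<n. X i j (mat_apply n Y \<xi> j))"
        by (intro sums_sum bounded_linear.sums[OF blinfun.bounded_linear_right] z_sums)
      then show ?thesis
        by (simp add: mat_apply_def blinfun.scaleR_right scaleR_sum_right)
    qed
    \<comment> \<open>Each term is \<open>z k i - z (Suc k) i\<close>, so the series telescopes to
      \<open>z 0 i = \<xi> i\<close>.\<close>
    moreover have "(\<lambda>k. \<epsilon> *\<^sub>R mat_apply n X (z k) i) sums \<xi> i"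
    proof -
      have "summable (\<lambda>k. z k i)"
        using summable_scaleR_right[OF sums_summable[OF z_sums], of "inverse \<epsilon>" i] \<open>0 < \<epsilon>\<close> by simp
      then have "(\<lambda>k. z k i) \<longlonglongrightarrow> 0"
        by (rule summable_LIMSEQ_zero)
      from telescope_sums'[OF this] show ?thesis
        using that by (simp add: z_def P_Suc P_0 mat_apply_mult T mat_apply_one)
    qed
    ultimately show ?thesis by (rule sums_unique2)
  qed
  with YA show thesis by (rule that)
qed

section \<open>Schur complements\<close>

text \<open>The cross terms cancel by bilinearity alone, so this applies to \<open>g\<close> in
  \<open>schur_step\<close>, which is known only through bounds on its form.\<close>

lemma mat_form_parallelogram:
  "mat_form n X (\<lambda>i. \<xi> i + \<eta> i) + mat_form n X (\<lambda>i. \<xi> i - \<eta> i) = 2 * mat_form n X \<xi> + 2 * mat_form n X \<eta>"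
  by (simp add: mat_form_def mat_apply_vec vec_inner_linear)

lemma mat_form_add_diff:
  assumes "mat_self_adjoint n X"
  shows "mat_form n X (\<lambda>i. \<xi> i + \<eta> i)
      = mat_form n X \<xi> + 2 * vec_inner n (mat_apply n X \<xi>) \<eta> + mat_form n X \<eta>"
    and "mat_form n X (\<lambda>i. \<xi> i - \<eta> i)
      = mat_form n X \<xi> - 2 * vec_inner n (mat_apply n X \<xi>) \<eta> + mat_form n X \<eta>"
  using mat_self_adjoint_inner[OF assms, of \<eta> \<xi>]
  by (simp_all add: mat_form_def mat_apply_vec vec_inner_linear vec_inner_commute[of n \<eta>])

text \<open>
  With \<open>R = m - e S\<^sup>-\<^sup>1 e\<close>. The lower bound on \<open>R\<close> comes from positivity of the block matrix
  with diagonal \<open>g, g\<close> and off-diagonal \<open>e\<close>, the other estimate from that of the block matrix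
  with diagonal \<open>S, e S\<^sup>-\<^sup>1 e\<close> and off-diagonal \<open>e\<close>.
\<close>
lemma schur_step:
  fixes A :: "('h::complex_hilbert_space \<Rightarrow>\<^sub>L 'h) set"
  assumes A: "unital_cstar_subalgebra A"
    and S: "S \<in> sa_matrices n A" and m: "m \<in> sa_matrices n A" and e: "e \<in> sa_matrices n A"
    and "0 < \<delta>" and g_pos: "\<And>\<xi>. \<delta> * vec_inner n \<xi> \<xi> \<le> mat_form n g \<xi>"
    and g_le: "\<And>\<xi>. mat_form n g \<xi> \<le> mat_form n S \<xi>"
    and e_le: "\<And>\<xi>. \<bar>mat_form n e \<xi>\<bar> \<le> mat_form n g \<xi>"
  obtains R where "R \<in> sa_matrices n A"
    and "\<And>\<xi>. mat_form n m \<xi> - mat_form n g \<xi> \<le> mat_form n R \<xi>"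
    and "\<And>\<xi>. 2 * \<bar>mat_form n e \<xi>\<bar> \<le> mat_form n S \<xi> + mat_form n m \<xi> - mat_form n R \<xi>"
proof -
  have sa: "mat_self_adjoint n S" "mat_self_adjoint n e"
    and op: "S \<in> op_matrices n A" "e \<in> op_matrices n A"
    using S e by (simp_all add: sa_matrices_def)
  have S_pos: "\<delta> * vec_inner n \<xi> \<xi> \<le> mat_form n S \<xi>" for \<xi>
    using g_pos g_le by (rule order_trans)
  obtain Y where YA: "Y \<in> op_matrices n A"
    and SY: "\<And>\<xi> i. i < n \<Longrightarrow> mat_apply n S (mat_apply n Y \<xi>) i = \<xi> i"
    using strictly_positive_matrix_inverse[OF A op(1) \<open>0 < \<delta>\<close> S_pos] by blast
  \<comment> \<open>Replace \<open>\<eta>\<close> by \<open>S Y \<eta>\<close>, move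
    \<open>S\<close> to the other side, and cancel \<open>S Y\<close> there: the right-inverse
    identity is applied twice.\<close>
  have Y: "mat_self_adjoint n Y"
    unfolding mat_self_adjoint_iff
  proof (intro allI)
    fix \<xi> \<eta>
    have "vec_cinner n (mat_apply n Y \<xi>) \<eta> = vec_cinner n (mat_apply n Y \<xi>) (mat_apply n S (mat_apply n Y \<eta>))"
      by (rule vec_cinner_cong) (simp_all add: SY)
    also have "\<dots> = vec_cinner n (mat_apply n S (mat_apply n Y \<xi>)) (mat_apply n Y \<eta>)"
      using sa(1) by (simp add: mat_self_adjoint_iff)
    also have "\<dots> = vec_cinner n \<xi> (mat_apply n Y \<eta>)"
      by (rule vec_cinner_cong) (simp_all add: SY)
    finally show "vec_cinner n (mat_apply n Y \<xi>) \<eta> = vec_cinner n \<xi> (mat_apply n Y \<eta>)" .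
  qed
  define E where "E = mat_mult n e (mat_mult n Y e)"
  have "mat_self_adjoint n E"
    using sa(2) Y by (simp add: mat_self_adjoint_iff E_def mat_apply_mult)
  then have E: "E \<in> sa_matrices n A"
    unfolding sa_matrices_def E_def using A op(2) YA by (simp add: op_matrices_closed)
  \<comment> \<open>\<open>w \<xi>\<close> solves \<open>S w = e \<xi>\<close>. The forms of
    \<open>S\<close> at \<open>w \<xi>\<close> and of \<open>E\<close> at \<open>\<xi>\<close> both
    equal the inner product of \<open>e \<xi>\<close> with \<open>w \<xi>\<close>.\<close>
  define w where "w = (\<lambda>\<xi>. mat_apply n Y (mat_apply n e \<xi>))"
  have Sw: "vec_inner n (mat_apply n S (w \<xi>)) \<eta> = vec_inner n (mat_apply n e \<xi>) \<eta>" for \<xi> \<eta>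
    by (rule vec_inner_cong) (simp_all add: w_def SY)
  have form_Sw: "mat_form n S (w \<xi>) = vec_inner n (mat_apply n e \<xi>) (w \<xi>)" for \<xi>
    unfolding mat_form_def by (rule Sw)
  have form_E: "mat_form n E \<xi> = vec_inner n (mat_apply n e \<xi>) (w \<xi>)" for \<xi>
    using mat_self_adjoint_inner[OF sa(2), of "w \<xi>" \<xi>]
    by (simp add: mat_form_def E_def mat_apply_mult w_def vec_inner_commute)
  \<comment> \<open>Subtracting the forms of \<open>e\<close> at \<open>\<xi> + w \<xi>\<close> and
    \<open>\<xi> - w \<xi>\<close> gives four times the form of \<open>E\<close>. By the
    parallelogram law this is at most \<open>2 g(\<xi>) + 2 g(w \<xi>)\<close>, and
    \<open>g(w \<xi>) \<le> S(w \<xi>) = E(\<xi>)\<close>.\<close>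
  have E_le: "mat_form n E \<xi> \<le> mat_form n g \<xi>" for \<xi>
    using mat_form_parallelogram[of n g \<xi> "w \<xi>"] mat_form_add_diff[OF sa(2), of \<xi> "w \<xi>"]
      e_le[of "\<lambda>i. \<xi> i + w \<xi> i"] e_le[of "\<lambda>i. \<xi> i - w \<xi> i"]
      g_le[of "w \<xi>"] form_Sw[of \<xi>] form_E[of \<xi>]
    by linarith
  have S_nonneg: "0 \<le> mat_form n S \<xi>" for \<xi>
    using S_pos[of \<xi>] \<open>0 < \<delta>\<close> vec_inner_self_nonneg[of n \<xi>]
    by (meson less_imp_le mult_nonneg_nonneg order_trans)
  \<comment> \<open>Expand the nonnegative forms of \<open>S\<close> at
    \<open>\<xi> + w \<xi>\<close> and \<open>\<xi> - w \<xi>\<close>; their cross term is twice the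
    form of \<open>e\<close>.\<close>
  have e_E: "2 * \<bar>mat_form n e \<xi>\<bar> \<le> mat_form n S \<xi> + mat_form n E \<xi>" for \<xi>
  proof -
    have "vec_inner n (mat_apply n S \<xi>) (w \<xi>) = mat_form n e \<xi>"
      using mat_self_adjoint_inner[OF sa(1), of \<xi> "w \<xi>"] Sw[of \<xi> \<xi>]
      by (simp add: mat_form_def vec_inner_commute)
    then show ?thesis
      using mat_form_add_diff[OF sa(1), of \<xi> "w \<xi>"] form_Sw[of \<xi>] form_E[of \<xi>]
        S_nonneg[of "\<lambda>i. \<xi> i + w \<xi> i"] S_nonneg[of "\<lambda>i. \<xi> i - w \<xi> i"]
      by linarith
  qed
  show thesis
  proof (rule that)
    show "(\<lambda>i j. m i j - E i j) \<in> sa_matrices n A"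
      using A m E by (rule sa_matrices_closed)
  next
    fix \<xi>
    show "mat_form n m \<xi> - mat_form n g \<xi> \<le> mat_form n (\<lambda>i j. m i j - E i j) \<xi>"
      using E_le[of \<xi>] by (simp add: mat_form_linear)
    show "2 * \<bar>mat_form n e \<xi>\<bar>
        \<le> mat_form n S \<xi> + mat_form n m \<xi> - mat_form n (\<lambda>i j. m i j - E i j) \<xi>"
      using e_E[of \<xi>] by (simp add: mat_form_linear)
  qed
qed

text \<open>
  In the iteration \<open>R\<^sub>k = m - e S\<^sub>k\<^sup>-\<^sup>1 e\<close>, \<open>S\<^sub>k\<^sub>+\<^sub>1 = m - f R\<^sub>k\<^sup>-\<^sup>1 f\<close> with \<open>S\<^sub>0 = m\<close>, the matrices
  are \<open>S = S\<^sub>N\<close> and \<open>U = \<Sum>k<N. S\<^sub>k + m - R\<^sub>k\<close>; the term \<open>m - S\<close> is what is left of a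
  telescoping sum.
\<close>
lemma schur_iteration:
  fixes A :: "('h::complex_hilbert_space \<Rightarrow>\<^sub>L 'h) set"
  assumes A: "unital_cstar_subalgebra A"
    and m: "m \<in> sa_matrices n A" and e: "e \<in> sa_matrices n A" and f: "f \<in> sa_matrices n A"
    and "0 < \<delta>" and g_pos: "\<And>\<xi>. \<delta> * vec_inner n \<xi> \<xi> \<le> mat_form n g \<xi>"
    and e_le: "\<And>\<xi>. \<bar>mat_form n e \<xi>\<bar> \<le> mat_form n g \<xi>"
    and h_pos: "\<And>\<xi>. \<delta> * vec_inner n \<xi> \<xi> \<le> mat_form n m \<xi> - mat_form n g \<xi>"
    and f_le: "\<And>\<xi>. \<bar>mat_form n f \<xi>\<bar> \<le> mat_form n m \<xi> - mat_form n g \<xi>"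
  shows "\<exists>S\<in>sa_matrices n A. \<exists>U\<in>sa_matrices n A.
    (\<forall>\<xi>. mat_form n g \<xi> \<le> mat_form n S \<xi>) \<and>
    (\<forall>\<xi>. 2 * real N * \<bar>mat_form n e \<xi>\<bar> \<le> mat_form n U \<xi>) \<and>
    (\<forall>\<xi>. 2 * real N * \<bar>mat_form n f \<xi>\<bar>
      \<le> 2 * real N * mat_form n m \<xi> - mat_form n U \<xi> + (mat_form n m \<xi> - mat_form n S \<xi>))"
proof (induction N)
  case 0
  \<comment> \<open>The start is \<open>S = m\<close> and the empty sum \<open>U = 0\<close>,
    written as a multiple of \<open>m\<close> so that the closure lemma covers it.\<close>
  have "mat_form n g \<xi> \<le> mat_form n m \<xi>" for \<xi>
    using f_le[of \<xi>] by linarith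
  moreover have "(\<lambda>i j. 0 *\<^sub>R m i j) \<in> sa_matrices n A"
    using A m by (rule sa_matrices_closed)
  moreover have "mat_form n (\<lambda>i j. 0 *\<^sub>R m i j) \<xi> = 0" for \<xi>
    by (simp only: mat_form_linear mult_zero_left)
  ultimately show ?case
    using m by (intro bexI[of _ m] bexI[of _ "\<lambda>i j. 0 *\<^sub>R m i j"]) simp_all
next
  case (Suc N)
  then obtain S U where S: "S \<in> sa_matrices n A" and U: "U \<in> sa_matrices n A"
    and g_le: "\<And>\<xi>. mat_form n g \<xi> \<le> mat_form n S \<xi>"
    and e_U: "\<And>\<xi>. 2 * real N * \<bar>mat_form n e \<xi>\<bar> \<le> mat_form n U \<xi>"
    and f_U: "\<And>\<xi>. 2 * real N * \<bar>mat_form n f \<xi>\<bar>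
      \<le> 2 * real N * mat_form n m \<xi> - mat_form n U \<xi> + (mat_form n m \<xi> - mat_form n S \<xi>)"
    by blast
  obtain R where R: "R \<in> sa_matrices n A"
    and h_le: "\<And>\<xi>. mat_form n m \<xi> - mat_form n g \<xi> \<le> mat_form n R \<xi>"
    and e_R: "\<And>\<xi>. 2 * \<bar>mat_form n e \<xi>\<bar> \<le> mat_form n S \<xi> + mat_form n m \<xi> - mat_form n R \<xi>"
    using schur_step[OF A S m e \<open>0 < \<delta>\<close> g_pos g_le e_le] by blast
  \<comment> \<open>The same step with \<open>R\<close>, \<open>f\<close> and \<open>m - g\<close>
    in place of \<open>S\<close>, \<open>e\<close> and \<open>g\<close>. Its lower bound
    \<open>m - (m - g)\<close> is \<open>g\<close> again, which restores the invariant.\<close>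
  obtain S' where S': "S' \<in> sa_matrices n A"
    and g_le': "\<And>\<xi>. mat_form n m \<xi> - (mat_form n m \<xi> - mat_form n g \<xi>) \<le> mat_form n S' \<xi>"
    and f_S': "\<And>\<xi>. 2 * \<bar>mat_form n f \<xi>\<bar> \<le> mat_form n R \<xi> + mat_form n m \<xi> - mat_form n S' \<xi>"
    using schur_step[OF A R m f \<open>0 < \<delta>\<close>, of "\<lambda>i j. m i j - g i j"] h_pos h_le f_le
    by (simp only: mat_form_linear) blast
  define U' where "U' = (\<lambda>i j. U i j + (S i j + (m i j - R i j)))"
  have U': "U' \<in> sa_matrices n A"
    unfolding U'_def using A U S m R by (intro sa_matrices_closed)
  have form_U': "mat_form n U' \<xi> = mat_form n U \<xi> + mat_form n S \<xi> + mat_form n m \<xi> - mat_form n R \<xi>" for \<xi>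
    by (simp add: U'_def mat_form_linear)
  \<comment> \<open>In the bound for \<open>f\<close> the right side grows by
    \<open>2 m - (S + m - R) + (S - S') = R + m - S'\<close>, which is what \<open>f_S'\<close>
    controls.\<close>
  have "2 * real (Suc N) * \<bar>mat_form n e \<xi>\<bar> \<le> mat_form n U' \<xi>"
    and "2 * real (Suc N) * \<bar>mat_form n f \<xi>\<bar>
      \<le> 2 * real (Suc N) * mat_form n m \<xi> - mat_form n U' \<xi> + (mat_form n m \<xi> - mat_form n S' \<xi>)" for \<xi>
    using e_U[of \<xi>] e_R[of \<xi>] f_U[of \<xi>] f_S'[of \<xi>] by (simp_all add: form_U' algebra_simps)
  then show ?case
    using S' U' g_le' by (intro bexI[of _ S'] bexI[of _ U']) simp_all
qed

section \<open>Interpolation between two lower and two upper bounds\<close>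

text \<open>The absolute values encode the pairs of bounds \<open>c \<plusminus> e\<close> and
  \<open>d \<plusminus> f\<close>. Of the \<open>\<delta>\<close> removed from \<open>d - c\<close>,
  one third shifts \<open>a\<close> upwards, one absorbs the telescoping error and one remains as
  the upper gap.\<close>

lemma sa_interpolation:
  fixes A :: "('h::complex_hilbert_space \<Rightarrow>\<^sub>L 'h) set"
  assumes A: "unital_cstar_subalgebra A"
    and c: "c \<in> sa_matrices n A" and d: "d \<in> sa_matrices n A"
    and e: "e \<in> sa_matrices n A" and f: "f \<in> sa_matrices n A"
    and "0 < \<delta>"
    and lower: "\<And>\<xi>. mat_form n c \<xi> + \<bar>mat_form n e \<xi>\<bar> + \<delta> * vec_inner n \<xi> \<xi> \<le> mat_form n b \<xi>"
    and upper: "\<And>\<xi>. mat_form n b \<xi> + \<bar>mat_form n f \<xi>\<bar> + \<delta> * vec_inner n \<xi> \<xi> \<le> mat_form n d \<xi>"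
  obtains a where "a \<in> sa_matrices n A"
    and "\<And>\<xi>. mat_form n c \<xi> + \<bar>mat_form n e \<xi>\<bar> + \<delta> / 3 * vec_inner n \<xi> \<xi> \<le> mat_form n a \<xi>"
    and "\<And>\<xi>. mat_form n a \<xi> + \<bar>mat_form n f \<xi>\<bar> + \<delta> / 3 * vec_inner n \<xi> \<xi> \<le> mat_form n d \<xi>"
proof -
  note one = mat_one_in_sa_matrices[OF A]
  \<comment> \<open>The reduction by \<open>\<delta>\<close> is shared equally: \<open>g\<close> and
    \<open>m - g\<close> each lose \<open>\<delta> / 2\<close> and keep a margin of
    \<open>\<delta> / 2\<close> over the forms of \<open>e\<close> and \<open>f\<close>.\<close>
  define m where "m = (\<lambda>i j. d i j - c i j - \<delta> *\<^sub>R mat_one n i j)"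
  define g where "g = (\<lambda>i j. b i j - c i j - (\<delta> / 2) *\<^sub>R mat_one n i j)"
  have mA: "m \<in> sa_matrices n A"
    unfolding m_def using A c d by (intro sa_matrices_closed one)
  have form_m: "mat_form n m \<xi> = mat_form n d \<xi> - mat_form n c \<xi> - \<delta> * vec_inner n \<xi> \<xi>" for \<xi>
    by (simp add: m_def mat_form_linear mat_form_one)
  have form_g: "mat_form n g \<xi> = mat_form n b \<xi> - mat_form n c \<xi> - \<delta> / 2 * vec_inner n \<xi> \<xi>" for \<xi>
    by (simp only: g_def mat_form_linear mat_form_one)
  have N_nonneg: "0 \<le> \<delta> * vec_inner n \<xi> \<xi>" for \<xi> :: "nat \<Rightarrow> 'h"
    using \<open>0 < \<delta>\<close> by (simp add: vec_inner_self_nonneg)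
  obtain K where K: "\<And>\<xi>. mat_form n m \<xi> \<le> K * vec_inner n \<xi> \<xi>"
    using mat_form_bounded by blast
  \<comment> \<open>Chosen so that the telescoping error, at most \<open>K / (2 N)\<close>, stays
    below \<open>\<delta> / 3\<close>. The absolute value also forces \<open>N\<close> to be
    positive.\<close>
  obtain N :: nat where N: "2 * \<bar>K\<bar> / \<delta> < real N"
    using reals_Archimedean2 by blast
  then have "0 < real N"
    using \<open>0 < \<delta>\<close> by (smt (verit) divide_nonneg_pos)
  have K_le: "K \<le> 2 * real N * (\<delta> / 3)"
  proof -
    have "2 * \<bar>K\<bar> < real N * \<delta>"
      using N \<open>0 < \<delta>\<close> by (simp add: divide_less_eq)
    then show ?thesis by (simp add: algebra_simps)
  qed
  have half: "\<delta> / 2 > 0" using \<open>0 < \<delta>\<close> by simp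
  have "\<delta> / 2 * vec_inner n \<xi> \<xi> \<le> mat_form n g \<xi>"
    and "\<bar>mat_form n e \<xi>\<bar> \<le> mat_form n g \<xi>"
    and "\<delta> / 2 * vec_inner n \<xi> \<xi> \<le> mat_form n m \<xi> - mat_form n g \<xi>"
    and "\<bar>mat_form n f \<xi>\<bar> \<le> mat_form n m \<xi> - mat_form n g \<xi>" for \<xi>
    using lower[of \<xi>] upper[of \<xi>] N_nonneg[of \<xi>] by (simp_all add: form_m form_g)
  \<comment> \<open>Chaining the lower bound of \<open>g\<close> with \<open>g \<le> S\<close>
    removes \<open>g\<close> and leaves \<open>S\<close> positive, so \<open>m - S\<close> is
    bounded by \<open>m\<close>.\<close>
  from schur_iteration[OF A mA e f half this, of N] this(1)
  obtain S U where U: "U \<in> sa_matrices n A"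
    and S_ge: "\<And>\<xi>. \<delta> / 2 * vec_inner n \<xi> \<xi> \<le> mat_form n S \<xi>"
    and e_U: "\<And>\<xi>. 2 * real N * \<bar>mat_form n e \<xi>\<bar> \<le> mat_form n U \<xi>"
    and f_U: "\<And>\<xi>. 2 * real N * \<bar>mat_form n f \<xi>\<bar>
      \<le> 2 * real N * mat_form n m \<xi> - mat_form n U \<xi> + (mat_form n m \<xi> - mat_form n S \<xi>)"
    by (meson order_trans)
  \<comment> \<open>\<open>U / (2 N)\<close> is the average of
    \<open>(S\<^sub>k + m - R\<^sub>k) / 2\<close>; the extra \<open>\<delta> / 3\<close> makes the
    lower inequalities strict.\<close>
  define a where "a = (\<lambda>i j. c i j + ((1 / (2 * real N)) *\<^sub>R U i j + (\<delta> / 3) *\<^sub>R mat_one n i j))"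
  have form_a: "mat_form n a \<xi>
      = mat_form n c \<xi> + (1 / (2 * real N) * mat_form n U \<xi> + \<delta> / 3 * vec_inner n \<xi> \<xi>)" for \<xi>
    by (simp only: a_def mat_form_linear mat_form_one)
  show thesis
  proof (rule that)
    show "a \<in> sa_matrices n A"
      unfolding a_def using A c U by (intro sa_matrices_closed one)
  next
    fix \<xi>
    let ?u = "1 / (2 * real N) * mat_form n U \<xi>"
    have U_eq: "mat_form n U \<xi> = 2 * real N * ?u"
      using \<open>0 < real N\<close> by simp
    have "2 * real N * \<bar>mat_form n e \<xi>\<bar> \<le> 2 * real N * ?u"
      using e_U[of \<xi>] U_eq by linarith
    then have "\<bar>mat_form n e \<xi>\<bar> \<le> ?u"
      by (rule mult_left_le_imp_le) (use \<open>0 < real N\<close> in simp)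
    then show "mat_form n c \<xi> + \<bar>mat_form n e \<xi>\<bar> + \<delta> / 3 * vec_inner n \<xi> \<xi> \<le> mat_form n a \<xi>"
      unfolding form_a by linarith
    have "mat_form n m \<xi> \<le> 2 * real N * (\<delta> / 3) * vec_inner n \<xi> \<xi>"
      using K[of \<xi>] mult_right_mono[OF K_le vec_inner_self_nonneg[of n \<xi>]] by (rule order_trans)
    then have "2 * real N * \<bar>mat_form n f \<xi>\<bar>
        \<le> 2 * real N * (mat_form n m \<xi> - ?u + \<delta> / 3 * vec_inner n \<xi> \<xi>)"
      unfolding distrib_left right_diff_distrib
      using f_U[of \<xi>] S_ge[of \<xi>] N_nonneg[of \<xi>] U_eq by linarith
    then have "\<bar>mat_form n f \<xi>\<bar> \<le> mat_form n m \<xi> - ?u + \<delta> / 3 * vec_inner n \<xi> \<xi>"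
      by (rule mult_left_le_imp_le) (use \<open>0 < real N\<close> in simp)
    then show "mat_form n a \<xi> + \<bar>mat_form n f \<xi>\<bar> + \<delta> / 3 * vec_inner n \<xi> \<xi> \<le> mat_form n d \<xi>"
      unfolding form_a form_m by linarith
  qed
qed

theorem theorem0p3:
  fixes A :: "('h::complex_hilbert_space \<Rightarrow>\<^sub>L 'h) set"
  assumes "unital_cstar_subalgebra A"
  shows "complete_TR_property 2 2 A bounded_operators"
  unfolding complete_TR_property_def TR_property_def
proof (intro allI impI, elim bexE conjE)
  fix n and x y :: "nat \<Rightarrow> 'h op_matrix" and b :: "'h op_matrix"
  assume x: "\<forall>i<2. x i \<in> op_matrices n A \<and> mat_self_adjoint n (x i)"
    and y: "\<forall>j<2. y j \<in> op_matrices n A \<and> mat_self_adjoint n (y j)"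
    and b: "mat_self_adjoint n b"
    and xb: "\<forall>i<2. mat_less n (x i) b" and yb: "\<forall>j<2. mat_less n b (y j)"
  have all_2: "(\<forall>i<2. P i) \<longleftrightarrow> P 0 \<and> P 1" for P :: "nat \<Rightarrow> bool"
    by (auto simp: less_2_cases_iff)
  have sa: "x 0 \<in> sa_matrices n A" "x 1 \<in> sa_matrices n A"
    "y 0 \<in> sa_matrices n A" "y 1 \<in> sa_matrices n A"
    using x y by (simp_all add: sa_matrices_def)
  obtain d0 d1 d2 d3 where d: "0 < d0" "0 < d1" "0 < d2" "0 < d3"
    and d0: "\<And>\<xi>. mat_form n (x 0) \<xi> + d0 * vec_inner n \<xi> \<xi> \<le> mat_form n b \<xi>"
    and d1: "\<And>\<xi>. mat_form n (x 1) \<xi> + d1 * vec_inner n \<xi> \<xi> \<le> mat_form n b \<xi>"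
    and d2: "\<And>\<xi>. mat_form n b \<xi> + d2 * vec_inner n \<xi> \<xi> \<le> mat_form n (y 0) \<xi>"
    and d3: "\<And>\<xi>. mat_form n b \<xi> + d3 * vec_inner n \<xi> \<xi> \<le> mat_form n (y 1) \<xi>"
    using xb yb x y b unfolding all_2 by (auto simp: mat_less_iff)
  define \<delta> where "\<delta> = min (min d0 d1) (min d2 d3)"
  have "0 < \<delta>" using d by (simp add: \<delta>_def)
  have \<delta>_le: "\<delta> * vec_inner n \<xi> \<xi> \<le> d0 * vec_inner n \<xi> \<xi>"
    "\<delta> * vec_inner n \<xi> \<xi> \<le> d1 * vec_inner n \<xi> \<xi>"
    "\<delta> * vec_inner n \<xi> \<xi> \<le> d2 * vec_inner n \<xi> \<xi>"
    "\<delta> * vec_inner n \<xi> \<xi> \<le> d3 * vec_inner n \<xi> \<xi>" for \<xi> :: "nat \<Rightarrow> 'h"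
    by (intro mult_right_mono vec_inner_self_nonneg; simp add: \<delta>_def)+
  define c where "c = (\<lambda>i j. (1/2) *\<^sub>R (x 0 i j + x 1 i j))"
  define e where "e = (\<lambda>i j. (1/2) *\<^sub>R (x 1 i j - x 0 i j))"
  define d where "d = (\<lambda>i j. (1/2) *\<^sub>R (y 0 i j + y 1 i j))"
  define f where "f = (\<lambda>i j. (1/2) *\<^sub>R (y 1 i j - y 0 i j))"
  have cA: "c \<in> sa_matrices n A" and dA: "d \<in> sa_matrices n A"
    and eA: "e \<in> sa_matrices n A" and fA: "f \<in> sa_matrices n A"
    unfolding c_def d_def e_def f_def using assms sa by (auto intro!: sa_matrices_closed)
  have forms: "mat_form n (x 0) \<xi> = mat_form n c \<xi> - mat_form n e \<xi>"
    "mat_form n (x 1) \<xi> = mat_form n c \<xi> + mat_form n e \<xi>"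
    "mat_form n (y 0) \<xi> = mat_form n d \<xi> - mat_form n f \<xi>"
    "mat_form n (y 1) \<xi> = mat_form n d \<xi> + mat_form n f \<xi>" for \<xi>
    by (simp_all only: c_def d_def e_def f_def mat_form_linear) (simp_all add: field_simps)
  \<comment> \<open>At each \<open>\<xi>\<close> the larger form of \<open>c \<plusminus> e\<close>
    is that of \<open>c\<close> plus the absolute value for \<open>e\<close>, so the two lower
    bounds merge into one; dually for \<open>d \<plusminus> f\<close>.\<close>
  have lower: "mat_form n c \<xi> + \<bar>mat_form n e \<xi>\<bar> + \<delta> * vec_inner n \<xi> \<xi> \<le> mat_form n b \<xi>" for \<xi>
    using d0[of \<xi>] d1[of \<xi>] \<delta>_le[of \<xi>] forms[of \<xi>] by linarith
  have upper: "mat_form n b \<xi> + \<bar>mat_form n f \<xi>\<bar> + \<delta> * vec_inner n \<xi> \<xi> \<le> mat_form n d \<xi>" for \<xi>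
    using d2[of \<xi>] d3[of \<xi>] \<delta>_le[of \<xi>] forms[of \<xi>] by linarith
  obtain a where aA: "a \<in> sa_matrices n A"
    and a_lower: "\<And>\<xi>. mat_form n c \<xi> + \<bar>mat_form n e \<xi>\<bar> + \<delta> / 3 * vec_inner n \<xi> \<xi> \<le> mat_form n a \<xi>"
    and a_upper: "\<And>\<xi>. mat_form n a \<xi> + \<bar>mat_form n f \<xi>\<bar> + \<delta> / 3 * vec_inner n \<xi> \<xi> \<le> mat_form n d \<xi>"
    using sa_interpolation[OF assms cA dA eA fA \<open>0 < \<delta>\<close> lower upper] by blast
  have a: "a \<in> op_matrices n A" "mat_self_adjoint n a"
    using aA by (simp_all add: sa_matrices_def)
  have "mat_form n (x 0) \<xi> + \<delta> / 3 * vec_inner n \<xi> \<xi> \<le> mat_form n a \<xi>"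
    "mat_form n (x 1) \<xi> + \<delta> / 3 * vec_inner n \<xi> \<xi> \<le> mat_form n a \<xi>"
    "mat_form n a \<xi> + \<delta> / 3 * vec_inner n \<xi> \<xi> \<le> mat_form n (y 0) \<xi>"
    "mat_form n a \<xi> + \<delta> / 3 * vec_inner n \<xi> \<xi> \<le> mat_form n (y 1) \<xi>" for \<xi>
    using a_lower[of \<xi>] a_upper[of \<xi>] forms[of \<xi>] by linarith+
  moreover have "0 < \<delta> / 3" using \<open>0 < \<delta>\<close> by simp
  ultimately have "(\<forall>i<2. mat_less n (x i) a) \<and> (\<forall>j<2. mat_less n a (y j))"
    using x y a(2) unfolding all_2 by (metis mat_less_iff)
  with a show "\<exists>a\<in>op_matrices n A. mat_self_adjoint n a \<and>
      (\<forall>i<2. mat_less n (x i) a) \<and> (\<forall>j<2. mat_less n a (y j))"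
    by blast
qed

end
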